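(* Let $\mathcal{C}$ be a configuration of curves in a smooth surface $\Sigma$ with ordinary multiple points, and let $\gamma_0\in\mathcal{C}$. Let $\mathcal{C}'=\mathcal{C}\setminus\{\gamma_0\}$ be the deleted arrangement and $\mathcal{C}''$ the restricted arrangement on $\gamma_0$, and let $v_0$ be the number of distinct singular points of $\mathcal{C}$ lying on $\gamma_0$ (counted set-theoretically). Then $$\chi(\mathcal{C},t)=\chi(\mathcal{C}',t)-\chi(\mathcal{C}'',t).$$
   Context: A configuration is a finite set $\mathcal{C}=\{\gamma_1,\dots,\gamma_n\}$ of distinct reduced irreducible curves in a smooth surface $\Sigma$ (in the algebraic case a smooth projective surface such as $\mathbb{P}^2$; in the semialgebraic case $\Sigma=\mathbb{R}^2$, with the curves forming a cell decomposition), all of whose mutual intersections are finitely many ordinary multiple points. $\operatorname{Sing}(\mathcal{C})$ is the set of points lying on at least two curves of $\mathcal{C}$, and $k_p=|\{i:p\in\gamma_i\}|$. The intersection poset $\mathcal{L}(\mathcal{C})$ consists of $\hat0=\Sigma$ (rank $0$, dimension $2$), the curves $\gamma_i$ (rank $1$, dimension $1$) and the points of $\operatorname{Sing}(\mathcal{C})$ (rank $2$, dimension $0$), ordered by reverse inclusion. With $\mu(X)=\mu(\hat0,X)$ its Möbius function, the characteristic generating function is $$\chi(\mathcal{C},t)=\sum_{X\in\mathcal{L}(\mathcal{C})}\mu(X)t^{\dim X}=t^2-nt+\sum_{p\in\operatorname{Sing}(\mathcal{C})}(k_p-1),$$ and similarly for $\mathcal{C}'$, with $\operatorname{Sing}(\mathcal{C}')$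 and multiplicities computed in $\mathcal{C}'$. The restricted arrangement is $\mathcal{C}''=\{p\in\gamma_0:p\in\operatorname{Sing}(\mathcal{C})\}$, viewed as an arrangement of points on the ambient curve $\gamma_0$; its poset consists of $\gamma_0$ (rank $0$, dimension $1$) and the points $p$ (rank $1$, dimension $0$), ordered by reverse inclusion, and $\chi(\mathcal{C}'',t)=\sum\mu(X)t^{\dim X}=t-v_0$. *)

theory Defs
  imports
    "HOL-Analysis.Analysis"
    "HOL-Library.Poly_Mapping"
    "HOL-Computational_Algebra.Polynomial"
begin

section \<open>Intersection posets and characteristic generating functions\<close>

text \<open>Elements of a poset are point sets, ordered by reverse inclusion: \<open>X \<le> Y\<close> iff \<open>Y \<subseteq> X\<close>.
  \<open>mobius L X Y\<close> is \<open>\<mu>(X, Y)\<close>, computed in the finite poset \<open>L\<close>; it is set to \<open>0\<close>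
  when \<open>X \<le> Y\<close> fails.\<close>

function mobius :: "'p set set \<Rightarrow> 'p set \<Rightarrow> 'p set \<Rightarrow> int" where
  "mobius L X Y =
     (if finite L \<and> X \<in> L \<and> Y \<in> L \<and> Y \<subseteq> X
      then if X = Y then 1 else - (\<Sum>Z\<in>{Z \<in> L. Z \<subseteq> X \<and> Y \<subset> Z}. mobius L X Z)
      else 0)"
  by pat_completeness auto
termination
proof (relation "Wellfounded.measure (\<lambda>(L, X, Y). card {Z \<in> L. Y \<subset> Z})", goal_cases)
  case 1
  show ?case by simp
next
  case (2 L X Y Z)
  then have "{W \<in> L. Z \<subset> W} \<subset> {W \<in> L. Y \<subset> W}" by blast
  with 2 show ?case by (simp add: psubset_card_mono)
qed

declare mobius.simps [simp del]

definition characteristic_function ::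
    "'p set set \<Rightarrow> 'p set \<Rightarrow> ('p set \<Rightarrow> nat) \<Rightarrow> int poly" where
  "characteristic_function L bottom dm = (\<Sum>X\<in>L. monom (mobius L bottom X) (dm X))"

definition Sing :: "'p set set \<Rightarrow> 'p set" where
  "Sing \<C> = {p. \<exists>\<gamma>\<in>\<C>. \<exists>\<gamma>'\<in>\<C>. \<gamma> \<noteq> \<gamma>' \<and> p \<in> \<gamma> \<and> p \<in> \<gamma>'}"

definition intersection_poset :: "'p set \<Rightarrow> 'p set set \<Rightarrow> 'p set set" where
  "intersection_poset \<Sigma> \<C> = {\<Sigma>} \<union> \<C> \<union> (\<lambda>p. {p}) ` Sing \<C>"

definition chi :: "'p set \<Rightarrow> 'p set set \<Rightarrow> int poly" where
  "chi \<Sigma> \<C> = characteristic_function (intersection_poset \<Sigma> \<C>) \<Sigma>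
     (\<lambda>X. if X = \<Sigma> then 2 else if X \<in> \<C> then 1 else 0)"

definition restricted_arrangement :: "'p set set \<Rightarrow> 'p set \<Rightarrow> 'p set" where
  "restricted_arrangement \<C> \<gamma>\<^sub>0 = {p \<in> \<gamma>\<^sub>0. p \<in> Sing \<C>}"

text \<open>The characteristic generating function of a set \<open>P\<close> of points on an ambient curve \<open>\<gamma>\<close>.\<close>

definition chi_points :: "'p set \<Rightarrow> 'p set \<Rightarrow> int poly" where
  "chi_points \<gamma> P = characteristic_function ({\<gamma>} \<union> (\<lambda>p. {p}) ` P) \<gamma>
     (\<lambda>X. if X = \<gamma> then 1 else 0)"


section \<open>Irreducibility and Krull dimension\<close>

definition irreducible_in :: "'p topology \<Rightarrow> 'p set \<Rightarrow> bool" where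
  "irreducible_in T S \<longleftrightarrow> S \<subseteq> topspace T \<and> S \<noteq> {} \<and>
     (\<forall>A B. closedin T A \<and> closedin T B \<and> S \<subseteq> A \<union> B \<longrightarrow> S \<subseteq> A \<or> S \<subseteq> B)"

definition irreducible_chain :: "'p topology \<Rightarrow> 'p set \<Rightarrow> (nat \<Rightarrow> 'p set) \<Rightarrow> nat \<Rightarrow> bool" where
  "irreducible_chain T S Z d \<longleftrightarrow>
     (\<forall>i\<le>d. closedin T (Z i) \<and> irreducible_in T (Z i) \<and> Z i \<subseteq> S) \<and> (\<forall>i<d. Z i \<subset> Z (Suc i))"

definition has_krull_dim :: "'p topology \<Rightarrow> 'p set \<Rightarrow> nat \<Rightarrow> bool" where
  "has_krull_dim T S d \<longleftrightarrow>
     (\<exists>Z. irreducible_chain T S Z d) \<and> (\<forall>e Z. irreducible_chain T S Z e \<longrightarrow> e \<le> d)"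


section \<open>Polynomials in several variables\<close>

type_synonym ('n, 'k) mpoly = "('n \<Rightarrow>\<^sub>0 nat) \<Rightarrow>\<^sub>0 'k"

definition eval_at :: "('n::finite, 'k::comm_semiring_1) mpoly \<Rightarrow> 'k ^ 'n \<Rightarrow> 'k" where
  "eval_at f x = (\<Sum>m\<in>Poly_Mapping.keys f.
     Poly_Mapping.lookup f m * (\<Prod>i\<in>UNIV. x $ i ^ Poly_Mapping.lookup m i))"

text \<open>The polynomial \<open>f (v + s w)\<close> in the variable \<open>s\<close>. Its coefficient of \<open>s ^ r\<close>, as a function
  of \<open>w\<close>, is the degree-\<open>r\<close> Taylor form of \<open>f\<close> at \<open>v\<close> (in any characteristic).\<close>

definition along_line :: "('n::finite, 'k::comm_semiring_1) mpoly \<Rightarrow> 'k ^ 'n \<Rightarrow> 'k ^ 'n \<Rightarrow> 'k poly" where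
  "along_line f v w = (\<Sum>m\<in>Poly_Mapping.keys f.
     smult (Poly_Mapping.lookup f m) (\<Prod>i\<in>UNIV. [:v $ i, w $ i:] ^ Poly_Mapping.lookup m i))"

definition taylor_form :: "nat \<Rightarrow> ('n::finite, 'k::comm_semiring_1) mpoly \<Rightarrow> 'k ^ 'n \<Rightarrow> 'k ^ 'n \<Rightarrow> 'k" where
  "taylor_form r f v w = coeff (along_line f v w) r"

definition vanishes_to_order :: "nat \<Rightarrow> ('n::finite, 'k::comm_semiring_1) mpoly \<Rightarrow> 'k ^ 'n \<Rightarrow> bool" where
  "vanishes_to_order r f v \<longleftrightarrow> (\<forall>j<r. \<forall>w. taylor_form j f v w = 0)"

definition homogeneous :: "('n::finite, 'k::zero) mpoly \<Rightarrow> bool" where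
  "homogeneous f \<longleftrightarrow> (\<exists>d. \<forall>m\<in>Poly_Mapping.keys f. (\<Sum>i\<in>UNIV. Poly_Mapping.lookup m i) = d)"


section \<open>The algebraic case: smooth projective surfaces\<close>

text \<open>A point of projective space is a line through the origin of \<open>'k ^ 'n\<close>, so the projective
  dimension is \<open>CARD('n) - 1\<close>. The ground field is algebraically closed, of any characteristic;
  reduced closed subschemes are identified with their sets of points.\<close>

definition projective_space :: "('k::field ^ 'n::finite) set set" where
  "projective_space = {l. vec.subspace l \<and> vec.dim l = 1}"

definition projective_zariski :: "('k::field ^ 'n::finite) set topology" where
  "projective_zariski = topology_generated_by
     {{l \<in> projective_space. \<exists>v\<in>l. eval_at f v \<noteq> 0} | f. homogeneous f}"

text \<open>The homogeneous elements of the vanishing ideal of \<open>S\<close>.\<close>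

definition vanishing_forms :: "('k::field ^ 'n::finite) set set \<Rightarrow> ('n, 'k) mpoly set" where
  "vanishing_forms S = {f. homogeneous f \<and> (\<forall>l\<in>S. \<forall>v\<in>l. eval_at f v = 0)}"

text \<open>The Zariski tangent space of the affine cone over \<open>S\<close> at \<open>v \<noteq> 0\<close>. It contains \<open>v\<close>, and its
  quotient by the line spanned by \<open>v\<close> is the tangent space of \<open>S\<close> at that line.\<close>

definition cone_tangent_space :: "('k::field ^ 'n::finite) set set \<Rightarrow> 'k ^ 'n \<Rightarrow> ('k ^ 'n) set" where
  "cone_tangent_space S v = {w. \<forall>f\<in>vanishing_forms S. taylor_form 1 f v w = 0}"

definition smooth_projective_surface :: "('k::field ^ 'n::finite) set set \<Rightarrow> bool" where
  "smooth_projective_surface \<Sigma> \<longleftrightarrow>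
     closedin projective_zariski \<Sigma> \<and> irreducible_in projective_zariski \<Sigma> \<and>
     has_krull_dim projective_zariski \<Sigma> 2 \<and>
     (\<forall>l\<in>\<Sigma>. \<forall>v\<in>l - {0}. vec.dim (cone_tangent_space \<Sigma> v) = 2 + 1)"

definition projective_curve_in :: "('k::field ^ 'n::finite) set set \<Rightarrow> ('k ^ 'n) set set \<Rightarrow> bool" where
  "projective_curve_in \<Sigma> \<gamma> \<longleftrightarrow>
     \<gamma> \<subseteq> \<Sigma> \<and> closedin projective_zariski \<gamma> \<and> irreducible_in projective_zariski \<gamma> \<and>
     has_krull_dim projective_zariski \<gamma> 1"

text \<open>The point \<open>l\<close> of the smooth surface \<open>\<Sigma>\<close> is an ordinary multiple point of the reduced curve
  \<open>D \<subseteq> \<Sigma>\<close>: for some \<open>r \<ge> 2\<close>, the curve has multiplicity \<open>r\<close> at \<open>l\<close> and \<open>r\<close> distinct tangents there.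
  The first conjunct says that the ideal of \<open>D\<close> in the local ring of \<open>\<Sigma>\<close> at \<open>l\<close> lies in the
  \<open>r\<close>-th power of the maximal ideal (the factor \<open>h\<close> is a unit of the local ring). The second says
  that some member of that ideal has a leading form of degree \<open>r\<close> which, on the tangent plane of
  \<open>\<Sigma>\<close> at \<open>l\<close>, vanishes exactly on \<open>r\<close> distinct lines; then it is a local equation of \<open>D\<close>, and its
  leading form is a product of \<open>r\<close> pairwise non-proportional linear forms. On the cone tangent
  space, lines in the tangent plane are the planes \<open>P\<close> that contain \<open>v\<close>.\<close>

definition projective_ordinary_multiple_point ::
    "('k::field ^ 'n::finite) set set \<Rightarrow> ('k ^ 'n) set set \<Rightarrow> ('k ^ 'n) set \<Rightarrow> bool" where
  "projective_ordinary_multiple_point \<Sigma> D l \<longleftrightarrow>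
     (\<exists>r\<ge>2. \<forall>v\<in>l - {0}.
        (\<forall>f\<in>vanishing_forms D. \<exists>h. \<exists>g\<in>vanishing_forms \<Sigma>.
           homogeneous h \<and> eval_at h v \<noteq> 0 \<and> vanishes_to_order r (h * f - g) v) \<and>
        (\<exists>f\<in>vanishing_forms D. vanishes_to_order r f v \<and>
           (\<exists>\<Lambda>. card \<Lambda> = r \<and> (\<forall>P\<in>\<Lambda>. vec.subspace P \<and> vec.dim P = 2 \<and> v \<in> P) \<and>
              {w \<in> cone_tangent_space \<Sigma> v. taylor_form r f v w = 0} = \<Union>\<Lambda>)))"

definition projective_configuration ::
    "('k::alg_closed_field ^ 'n::finite) set set \<Rightarrow> ('k ^ 'n) set set set \<Rightarrow> bool" where
  "projective_configuration \<Sigma> \<C> \<longleftrightarrow>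
     smooth_projective_surface \<Sigma> \<and> finite \<C> \<and> (\<forall>\<gamma>\<in>\<C>. projective_curve_in \<Sigma> \<gamma>) \<and>
     finite (Sing \<C>) \<and> (\<forall>p\<in>Sing \<C>. projective_ordinary_multiple_point \<Sigma> (\<Union>\<C>) p)"


section \<open>The semialgebraic case: the real plane\<close>

inductive semialgebraic :: "(real ^ 'n::finite) set \<Rightarrow> bool" where
  positive: "semialgebraic {x. eval_at f x > 0}"
| complement: "semialgebraic A \<Longrightarrow> semialgebraic (- A)"
| union: "semialgebraic A \<Longrightarrow> semialgebraic B \<Longrightarrow> semialgebraic (A \<union> B)"

definition affine_zariski :: "(real ^ 'n::finite) topology" where
  "affine_zariski = topology_generated_by {{x. eval_at f x \<noteq> 0} | f. True}"

text \<open>Dimension and irreducibility of a semialgebraic set are those of its Zariski closure.\<close>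

definition semialgebraic_curve :: "(real ^ 2) set \<Rightarrow> bool" where
  "semialgebraic_curve \<gamma> \<longleftrightarrow> semialgebraic \<gamma> \<and> closed \<gamma> \<and>
     irreducible_in affine_zariski (affine_zariski closure_of \<gamma>) \<and>
     has_krull_dim affine_zariski (affine_zariski closure_of \<gamma>) 1"

text \<open>\<open>B\<close> is a smooth embedded open arc through \<open>p\<close> with tangent direction \<open>u\<close> at \<open>p\<close>;
  \<open>G k\<close> is the \<open>k\<close>-th derivative of its parametrization.\<close>

definition smooth_arc :: "(real ^ 2) set \<Rightarrow> real ^ 2 \<Rightarrow> real ^ 2 \<Rightarrow> bool" where
  "smooth_arc B p u \<longleftrightarrow>
     (\<exists>G :: nat \<Rightarrow> real \<Rightarrow> real ^ 2.
        (\<exists>g'. homeomorphism {-1<..<1} B (G 0) g') \<and>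
        (\<forall>k. \<forall>t\<in>{-1<..<1}. (G k has_vector_derivative G (Suc k) t) (at t)) \<and>
        (\<forall>t\<in>{-1<..<1}. G 1 t \<noteq> 0) \<and> G 0 0 = p \<and> G 1 0 = u)"

text \<open>Near \<open>p\<close>, the union of the curves consists of \<open>r \<ge> 2\<close> smooth arcs through \<open>p\<close> with pairwise
  distinct tangent lines, and each curve consists of some of these arcs.\<close>

definition real_ordinary_multiple_point :: "(real ^ 2) set set \<Rightarrow> real ^ 2 \<Rightarrow> bool" where
  "real_ordinary_multiple_point \<C> p \<longleftrightarrow>
     (\<exists>U r B u. open U \<and> p \<in> U \<and> r \<ge> (2::nat) \<and>
        (\<forall>j<r. smooth_arc (B j) p (u j)) \<and>
        (\<forall>i<r. \<forall>j<r. i \<noteq> j \<longrightarrow> \<not> collinear {0, u i, u j}) \<and>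
        \<Union>\<C> \<inter> U = (\<Union>j<r. B j) \<and>
        (\<forall>\<gamma>\<in>\<C>. \<exists>J\<subseteq>{..<r}. \<gamma> \<inter> U = (\<Union>j\<in>J. B j)))"

text \<open>A finite decomposition of the whole space; \<open>E d\<close> is the set of open \<open>d\<close>-cells.
  The cells may be unbounded.\<close>

definition cell_decomposition :: "(nat \<Rightarrow> 'a::topological_space set set) \<Rightarrow> bool" where
  "cell_decomposition E \<longleftrightarrow>
     finite (\<Union>d. E d) \<and> disjoint (\<Union>d. E d) \<and> \<Union>(\<Union>d. E d) = UNIV \<and>
     (\<forall>d. \<forall>e\<in>E d. top_of_set e homeomorphic_space Euclidean_space d \<and>
        (\<exists>F \<subseteq> (\<Union>i<d. E i). closure e - e = \<Union>F))"

text \<open>The curves form a cell decomposition: their union is the \<open>1\<close>-skeleton, and the points of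
  \<open>Sing \<C>\<close> are vertices. Further vertices are permitted (for example on a closed oval).\<close>

definition forms_cell_decomposition :: "(real ^ 2) set set \<Rightarrow> bool" where
  "forms_cell_decomposition \<C> \<longleftrightarrow>
     (\<exists>E. cell_decomposition E \<and> \<Union>\<C> = \<Union>(E 0 \<union> E 1) \<and> (\<forall>p\<in>Sing \<C>. {p} \<in> E 0))"

definition semialgebraic_configuration :: "(real ^ 2) set set \<Rightarrow> bool" where
  "semialgebraic_configuration \<C> \<longleftrightarrow>
     finite \<C> \<and> (\<forall>\<gamma>\<in>\<C>. semialgebraic_curve \<gamma>) \<and> forms_cell_decomposition \<C> \<and>
     finite (Sing \<C>) \<and> (\<forall>p\<in>Sing \<C>. real_ordinary_multiple_point \<C> p)"

end

theory Submission
  imports Defs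
begin

text \<open>Geometry enters only through an incidence pattern: the curves are proper subsets of the surface,
  none of them contains another, none is a single point, and their singular points are finite in
  number. In such a pattern (locale \<open>curve_arrangement\<close>) everything strictly above a curve is the
  surface, and everything strictly above a singular point \<open>p\<close> is the surface and the \<open>k\<^sub>p\<close> curves
  through \<open>p\<close>. So the Moebius function takes the values \<open>1\<close>, \<open>-1\<close> and \<open>k\<^sub>p - 1\<close>, and
  \<open>\<chi>(\<C>, t) = t\<^sup>2 - n t + \<Sum>\<^sub>p (k\<^sub>p - 1)\<close> (lemma \<open>chi_eq\<close>). Deleting \<open>\<gamma>\<^sub>0\<close> lowers \<open>n\<close> by one and lowers
  \<open>k\<^sub>p\<close> by one exactly at the \<open>v\<^sub>0\<close> singular points on \<open>\<gamma>\<^sub>0\<close>; a point which thereby ceases to be singular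
  has \<open>k\<^sub>p = 1\<close> afterwards and contributes \<open>0\<close>. The total change is \<open>-t + v\<^sub>0 = -\<chi>(\<C>'', t)\<close>.

  It remains to find the pattern in both geometries. In the projective case it follows from Krull
  dimension: a closed irreducible proper superset lengthens every chain. In the semialgebraic
  case a curve may be a proper part of its Zariski closure, so that dimension alone does not forbid
  one curve inside another (a segment in a line). But then the smaller curve would consist
  of singular points and be finite, whereas a finite set has Krull dimension at most \<open>0\<close>, points being
  Zariski closed. Finally the plane is not a curve, since it has the chain point, line, plane;
  the irreducibility of these three comes from the fact that a polynomial in one variable has
  finitely many zeros.\<close>

section \<open>Characteristic functions of arrangements\<close>

lemma mobius_refl: "finite L \<Longrightarrow> X \<in> L \<Longrightarrow> mobius L X X = 1"
  by (subst mobius.simps) simp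

lemma mobius_strict:
  assumes "finite L" "X \<in> L" "Y \<in> L" "Y \<subset> X"
  shows "mobius L X Y = - (\<Sum>Z\<in>{Z \<in> L. Z \<subseteq> X \<and> Y \<subset> Z}. mobius L X Z)"
  using assms by (subst mobius.simps) auto

lemma mobius_atom:
  assumes "finite L" "X \<in> L" "Y \<in> L" "Y \<subset> X"
    and "\<And>Z. Z \<in> L \<Longrightarrow> Z \<subseteq> X \<Longrightarrow> Y \<subset> Z \<Longrightarrow> Z = X"
  shows "mobius L X Y = -1"
proof -
  have "{Z \<in> L. Z \<subseteq> X \<and> Y \<subset> Z} = {X}"
    using assms by blast
  then show ?thesis
    using assms by (simp add: mobius_strict mobius_refl)
qed

lemma sum_monom_0: "(\<Sum>x\<in>A. monom (f x) 0) = monom (\<Sum>x\<in>A. f x) 0"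
  by (induction A rule: infinite_finite_induct) (simp_all add: add_monom)

lemma chi_points_eq:
  assumes "finite P" "P \<subseteq> \<gamma>" "\<And>p. \<gamma> \<noteq> {p}"
  shows "chi_points \<gamma> P = monom 1 1 - monom (int (card P)) 0"
proof -
  define L where "L = {\<gamma>} \<union> (\<lambda>p. {p}) ` P"
  have L: "finite L" "\<gamma> \<in> L"
    using assms by (auto simp: L_def)
  have point: "mobius L \<gamma> {p} = -1" if "p \<in> P" for p
  proof (rule mobius_atom)
    show "{p} \<in> L" "{p} \<subset> \<gamma>"
      using that assms(2) assms(3)[of p] by (auto simp: L_def)
  qed (use L in \<open>auto simp: L_def\<close>)
  have "chi_points \<gamma> P = (\<Sum>X\<in>{\<gamma>} \<union> (\<lambda>p. {p}) ` P. monom (mobius L \<gamma> X) (if X = \<gamma> then 1 else 0))"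
    by (simp add: chi_points_def characteristic_function_def L_def)
  also have "\<dots> = monom (mobius L \<gamma> \<gamma>) 1
      + (\<Sum>X\<in>(\<lambda>p. {p}) ` P. monom (mobius L \<gamma> X) (if X = \<gamma> then 1 else 0))"
    using assms by (subst sum.union_disjoint) auto
  also have "(\<Sum>X\<in>(\<lambda>p. {p}) ` P. monom (mobius L \<gamma> X) (if X = \<gamma> then 1 else 0))
      = (\<Sum>p\<in>P. monom (-1) 0)"
    using assms(3)[symmetric] point
    by (subst sum.reindex) (auto simp del: sum_constant intro!: sum.cong)
  finally show ?thesis
    using L by (simp only: mobius_refl sum_monom_0) (simp add: minus_monom)
qed

definition multiplicity_at :: "'p set set \<Rightarrow> 'p \<Rightarrow> nat" where
  "multiplicity_at \<C> p = card {\<gamma> \<in> \<C>. p \<in> \<gamma>}"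

locale curve_arrangement =
  fixes \<Sigma> :: "'p set" and \<C> :: "'p set set"
  assumes finite_curves: "finite \<C>"
    and finite_Sing: "finite (Sing \<C>)"
    and curve_proper: "\<gamma> \<in> \<C> \<Longrightarrow> \<gamma> \<subset> \<Sigma>"
    and curve_antichain: "\<gamma> \<in> \<C> \<Longrightarrow> \<gamma>' \<in> \<C> \<Longrightarrow> \<not> \<gamma> \<subset> \<gamma>'"
    and curve_not_point: "\<gamma> \<in> \<C> \<Longrightarrow> \<gamma> \<noteq> {p}"
begin

lemma deletion: "curve_arrangement \<Sigma> (\<C> - {\<gamma>})"
proof
  show "finite (Sing (\<C> - {\<gamma>}))"
    by (rule finite_subset[OF _ finite_Sing]) (auto simp: Sing_def)
qed (use finite_curves curve_proper curve_antichain curve_not_point in auto)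

lemma chi_eq:
  "chi \<Sigma> \<C> = monom 1 2 - monom (int (card \<C>)) 1
     + monom (\<Sum>p\<in>Sing \<C>. int (multiplicity_at \<C> p) - 1) 0"
proof -
  define L where "L = intersection_poset \<Sigma> \<C>"
  define dm where "dm = (\<lambda>X. if X = \<Sigma> then 2 else if X \<in> \<C> then 1 else (0::nat))"
  have L: "finite L" "\<Sigma> \<in> L"
    using finite_curves finite_Sing by (auto simp: L_def intersection_poset_def)
  have \<Sigma>: "\<Sigma> \<notin> \<C>"
    using curve_proper by blast
  have point_proper: "{p} \<subset> \<Sigma>" if "p \<in> Sing \<C>" for p
    using that curve_proper by (fastforce simp: Sing_def)
  have point_not_curve: "{p} \<notin> \<C>" for p
    using curve_not_point by blast
  have curve: "mobius L \<Sigma> \<gamma> = -1" if "\<gamma> \<in> \<C>" for \<gamma>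
  proof (rule mobius_atom)
    show "\<gamma> \<in> L" "\<gamma> \<subset> \<Sigma>"
      using that curve_proper by (auto simp: L_def intersection_poset_def)
    show "Z = \<Sigma>" if Z: "Z \<in> L" "\<gamma> \<subset> Z" for Z
    proof (rule ccontr)
      assume "Z \<noteq> \<Sigma>"
      then consider "Z \<in> \<C>" | p where "p \<in> Sing \<C>" "Z = {p}"
        using Z by (auto simp: L_def intersection_poset_def)
      then show False
      proof cases
        case 1
        then show ?thesis using Z \<open>\<gamma> \<in> \<C>\<close> curve_antichain by blast
      next
        case 2
        then have "\<gamma> = {}" using Z by auto
        \<comment> \<open>A singular point lies on two curves, and an empty curve would be contained in them.\<close>
        then show ?thesis using 2 \<open>\<gamma> \<in> \<C>\<close> curve_antichain by (fastforce simp: Sing_def)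
      qed
    qed
  qed (use L in auto)
  have point: "mobius L \<Sigma> {p} = int (multiplicity_at \<C> p) - 1" if p: "p \<in> Sing \<C>" for p
  proof -
    have above: "{Z \<in> L. Z \<subseteq> \<Sigma> \<and> {p} \<subset> Z} = insert \<Sigma> {\<gamma> \<in> \<C>. p \<in> \<gamma>}"
      using point_proper[OF p] point_not_curve[of p] curve_proper
      by (auto simp: L_def intersection_poset_def)
    have "{p} \<in> L"
      using p by (auto simp: L_def intersection_poset_def)
    then have "mobius L \<Sigma> {p} = - (\<Sum>Z\<in>insert \<Sigma> {\<gamma> \<in> \<C>. p \<in> \<gamma>}. mobius L \<Sigma> Z)"
      using mobius_strict[OF L _ point_proper[OF p]] above by simp
    also have "\<dots> = - (1 + (\<Sum>\<gamma>\<in>{\<gamma> \<in> \<C>. p \<in> \<gamma>}. -1))"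
      using \<Sigma> finite_curves L curve by (simp add: mobius_refl)
    finally show ?thesis
      by (simp add: multiplicity_at_def)
  qed
  have "chi \<Sigma> \<C> = (\<Sum>X\<in>L. monom (mobius L \<Sigma> X) (dm X))"
    by (simp add: chi_def characteristic_function_def L_def dm_def)
  also have "\<dots> = (\<Sum>X\<in>{\<Sigma>}. monom (mobius L \<Sigma> X) (dm X)) + (\<Sum>X\<in>\<C>. monom (mobius L \<Sigma> X) (dm X))
      + (\<Sum>X\<in>(\<lambda>p. {p}) ` Sing \<C>. monom (mobius L \<Sigma> X) (dm X))"
  proof -
    have "L = ({\<Sigma>} \<union> \<C>) \<union> (\<lambda>p. {p}) ` Sing \<C>"
      by (simp add: L_def intersection_poset_def)
    moreover have "({\<Sigma>} \<union> \<C>) \<inter> (\<lambda>p. {p}) ` Sing \<C> = {}"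
      using point_proper point_not_curve by blast
    ultimately show ?thesis
      using \<Sigma> finite_curves finite_Sing
      by (simp add: sum.union_disjoint del: Un_insert_left)
  qed
  also have "(\<Sum>X\<in>{\<Sigma>}. monom (mobius L \<Sigma> X) (dm X)) = monom 1 2"
    using L by (simp add: mobius_refl dm_def)
  also have "(\<Sum>X\<in>\<C>. monom (mobius L \<Sigma> X) (dm X)) = (\<Sum>X\<in>\<C>. monom (-1) 1)"
    using \<Sigma> curve by (intro sum.cong) (auto simp: dm_def)
  also have "\<dots> = - monom (int (card \<C>)) 1"
    by (simp add: of_nat_poly minus_monom[symmetric] smult_monom)
  also have "(\<Sum>X\<in>(\<lambda>p. {p}) ` Sing \<C>. monom (mobius L \<Sigma> X) (dm X))
      = (\<Sum>p\<in>Sing \<C>. monom (int (multiplicity_at \<C> p) - 1) 0)"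
  proof -
    have "dm {p} = 0" if "p \<in> Sing \<C>" for p
      using point_proper[OF that] point_not_curve[of p] by (auto simp: dm_def)
    then show ?thesis
      using point by (subst sum.reindex) auto
  qed
  finally show ?thesis
    by (simp add: sum_monom_0)
qed

lemma sum_multiplicity_deletion:
  assumes "\<gamma>\<^sub>0 \<in> \<C>"
  shows "(\<Sum>p\<in>Sing \<C>. int (multiplicity_at \<C> p) - 1)
    = (\<Sum>p\<in>Sing (\<C> - {\<gamma>\<^sub>0}). int (multiplicity_at (\<C> - {\<gamma>\<^sub>0}) p) - 1)
      + int (card (restricted_arrangement \<C> \<gamma>\<^sub>0))"
proof -
  let ?C = "\<C> - {\<gamma>\<^sub>0}"
  have smooth: "multiplicity_at ?C p = 1" if p: "p \<in> Sing \<C> - Sing ?C" for p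
  proof -
    obtain \<gamma> where \<gamma>: "\<gamma> \<in> ?C" "p \<in> \<gamma>"
      using p by (auto simp: Sing_def)
    then have "{\<gamma> \<in> ?C. p \<in> \<gamma>} = {\<gamma>}"
      using p by (auto simp: Sing_def)
    then show ?thesis
      by (simp add: multiplicity_at_def)
  qed
  have step: "int (multiplicity_at \<C> p) = int (multiplicity_at ?C p) + (if p \<in> \<gamma>\<^sub>0 then 1 else 0)"
    for p
  proof (cases "p \<in> \<gamma>\<^sub>0")
    case True
    then have "{\<gamma> \<in> \<C>. p \<in> \<gamma>} = insert \<gamma>\<^sub>0 {\<gamma> \<in> ?C. p \<in> \<gamma>}"
      using assms by blast
    then show ?thesis
      using True finite_curves by (simp add: multiplicity_at_def)
  next
    case False
    then have "{\<gamma> \<in> \<C>. p \<in> \<gamma>} = {\<gamma> \<in> ?C. p \<in> \<gamma>}"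
      by blast
    then show ?thesis
      using False by (simp add: multiplicity_at_def)
  qed
  have "(\<Sum>p\<in>Sing \<C>. int (multiplicity_at \<C> p) - 1)
      = (\<Sum>p\<in>Sing \<C>. int (multiplicity_at ?C p) - 1) + (\<Sum>p\<in>Sing \<C>. if p \<in> \<gamma>\<^sub>0 then 1 else 0)"
    unfolding sum.distrib[symmetric] by (intro sum.cong refl) (simp add: step)
  also have "(\<Sum>p\<in>Sing \<C>. int (multiplicity_at ?C p) - 1)
      = (\<Sum>p\<in>Sing ?C. int (multiplicity_at ?C p) - 1)"
  proof (rule sum.mono_neutral_right[OF finite_Sing])
    show "Sing ?C \<subseteq> Sing \<C>"
      by (auto simp: Sing_def)
  qed (use smooth in simp)
  also have "(\<Sum>p\<in>Sing \<C>. if p \<in> \<gamma>\<^sub>0 then 1 else 0) = int (card (restricted_arrangement \<C> \<gamma>\<^sub>0))"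
    using finite_Sing
    by (simp add: sum.If_cases restricted_arrangement_def Int_def conj_commute)
  finally show ?thesis .
qed

theorem chi_deletion_restriction:
  assumes "\<gamma>\<^sub>0 \<in> \<C>"
  shows "chi \<Sigma> \<C> = chi \<Sigma> (\<C> - {\<gamma>\<^sub>0}) - chi_points \<gamma>\<^sub>0 (restricted_arrangement \<C> \<gamma>\<^sub>0)"
proof -
  have "chi_points \<gamma>\<^sub>0 (restricted_arrangement \<C> \<gamma>\<^sub>0)
      = monom 1 1 - monom (int (card (restricted_arrangement \<C> \<gamma>\<^sub>0))) 0"
    using finite_Sing curve_not_point[OF assms]
    by (intro chi_points_eq) (auto simp: restricted_arrangement_def)
  moreover have "int (card \<C>) = int (card (\<C> - {\<gamma>\<^sub>0})) + 1"
    by (metis assms finite_curves card_Suc_Diff1 of_nat_Suc add.commute)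
  ultimately show ?thesis
    unfolding chi_eq curve_arrangement.chi_eq[OF deletion] sum_multiplicity_deletion[OF assms]
    by (simp only: add_monom[symmetric])
qed

end


section \<open>Krull dimension\<close>

lemma has_krull_dim_unique: "has_krull_dim T S d \<Longrightarrow> has_krull_dim T S e \<Longrightarrow> d = e"
  unfolding has_krull_dim_def by (meson le_antisym)

lemma has_krull_dim_psubset:
  assumes "has_krull_dim T S d" "S \<subset> S'" "closedin T S'" "irreducible_in T S'"
    and "has_krull_dim T S' e"
  shows "d < e"
proof -
  obtain Z where Z: "irreducible_chain T S Z d"
    using assms(1) by (auto simp: has_krull_dim_def)
  have "irreducible_chain T S' (Z(Suc d := S')) (Suc d)"
    using Z assms(2-4) by (auto simp: irreducible_chain_def le_Suc_eq less_Suc_eq)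
  then show ?thesis
    using assms(5) by (auto simp: has_krull_dim_def)
qed

lemma has_krull_dim_Suc_not_singleton:
  assumes "has_krull_dim T S (Suc d)"
  shows "S \<noteq> {p}"
proof
  assume "S = {p}"
  moreover obtain Z where "irreducible_chain T S Z (Suc d)"
    using assms by (auto simp: has_krull_dim_def)
  ultimately have "Z 0 \<noteq> {}" "Z 0 \<subset> Z 1" "Z 1 \<subseteq> {p}"
    by (auto simp: irreducible_chain_def irreducible_in_def)
  then show False by blast
qed

text \<open>A finite set is the union of its points, so when points are closed an irreducible one can only be
  a single point, and no chain has a second member.\<close>

lemma has_krull_dim_Suc_infinite:
  assumes "has_krull_dim T S (Suc d)" "\<And>p. closedin T {p}"
  shows "infinite S"
proof
  assume fin: "finite S"
  obtain Z where Z: "irreducible_chain T S Z (Suc d)"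
    using assms by (auto simp: has_krull_dim_def)
  then have Z01: "Z 0 \<noteq> {}" "Z 0 \<subset> Z 1" and Z1: "Z 1 \<subseteq> S" "irreducible_in T (Z 1)"
    by (auto simp: irreducible_chain_def irreducible_in_def)
  then obtain p where p: "p \<in> Z 0" by blast
  have "closedin T (\<Union>q\<in>Z 1 - {p}. {q})"
    using finite_subset[OF Z1(1) fin] assms(2) by (intro closedin_Union) auto
  then have "closedin T (Z 1 - {p})" by simp
  then have "Z 1 \<subseteq> {p} \<or> Z 1 \<subseteq> Z 1 - {p}"
    using Z1(2) assms(2)[of p] unfolding irreducible_in_def by blast
  then show False
    using Z01 p by blast
qed


section \<open>Projective configurations\<close>

lemma projective_configuration_arrangement:
  assumes "projective_configuration \<Sigma> \<C>"
  shows "curve_arrangement \<Sigma> \<C>"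
proof
  have surface: "has_krull_dim projective_zariski \<Sigma> 2"
    and curve: "\<And>\<gamma>. \<gamma> \<in> \<C> \<Longrightarrow> projective_curve_in \<Sigma> \<gamma>"
    using assms by (auto simp: projective_configuration_def smooth_projective_surface_def)
  show "finite \<C>" "finite (Sing \<C>)"
    using assms by (auto simp: projective_configuration_def)
  show "\<gamma> \<subset> \<Sigma>" if "\<gamma> \<in> \<C>" for \<gamma>
    using curve[OF that] surface has_krull_dim_unique[of projective_zariski \<Sigma> 1 2]
    by (auto simp: projective_curve_in_def)
  show "\<not> \<gamma> \<subset> \<gamma>'" if "\<gamma> \<in> \<C>" "\<gamma>' \<in> \<C>" for \<gamma> \<gamma>'
    using curve[OF that(1)] curve[OF that(2)] has_krull_dim_psubset[of projective_zariski \<gamma> 1 \<gamma>' 1]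
    by (auto simp: projective_curve_in_def)
  show "\<gamma> \<noteq> {p}" if "\<gamma> \<in> \<C>" for \<gamma> p
    using curve[OF that] has_krull_dim_Suc_not_singleton[of projective_zariski \<gamma> 0 p]
    by (auto simp: projective_curve_in_def)
qed


section \<open>The real affine Zariski topology\<close>

lemma eval_at_superset:
  assumes "finite A" "Poly_Mapping.keys f \<subseteq> A"
  shows "eval_at f x = (\<Sum>m\<in>A. Poly_Mapping.lookup f m * (\<Prod>i\<in>UNIV. x $ i ^ Poly_Mapping.lookup m i))"
  unfolding eval_at_def using assms
  by (intro sum.mono_neutral_left) (auto simp: in_keys_iff)

lemma eval_at_add: "eval_at (f + g) x = eval_at f x + eval_at g x"
proof -
  let ?A = "Poly_Mapping.keys f \<union> Poly_Mapping.keys g"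
  have "Poly_Mapping.keys (f + g) \<subseteq> ?A"
    by (rule Poly_Mapping.keys_add)
  then show ?thesis
    by (simp add: eval_at_superset[of ?A] lookup_add distrib_right sum.distrib)
qed

lemma eval_at_const: "eval_at (Poly_Mapping.single 0 c) x = c"
  by (simp add: eval_at_superset[of "{0}"])

lemma eval_at_variable: "eval_at (Poly_Mapping.single (Poly_Mapping.single i (Suc 0)) 1) x = x $ i"
proof -
  have "(\<Prod>j\<in>UNIV. x $ j ^ Poly_Mapping.lookup (Poly_Mapping.single i (Suc 0)) j)
      = (\<Prod>j\<in>UNIV. if j = i then x $ j else 1)"
    by (intro prod.cong) (auto simp: lookup_single when_def)
  then show ?thesis
    by (simp add: eval_at_superset[of "{Poly_Mapping.single i (Suc 0)}"])
qed

lemma poly_along_line: "poly (along_line f v w) s = eval_at f (v + s *s w)"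
  by (simp add: along_line_def eval_at_def poly_sum poly_prod algebra_simps)

lemma topspace_affine_zariski: "topspace affine_zariski = UNIV"
proof -
  have "UNIV \<in> {{x :: real ^ 'n. eval_at f x \<noteq> 0} | f. True}"
    by (rule CollectI, rule exI[of _ "Poly_Mapping.single 0 1"]) (simp add: eval_at_const del: single_one)
  then show ?thesis
    unfolding affine_zariski_def topology_generated_by_topspace by blast
qed

lemma closedin_affine_zariski_zeros: "closedin affine_zariski {x. eval_at f x = 0}"
proof -
  have "openin affine_zariski {x. eval_at f x \<noteq> 0}"
    unfolding affine_zariski_def by (rule topology_generated_by_Basis) blast
  moreover have "- {x. eval_at f x = 0} = {x. eval_at f x \<noteq> 0}"
    by blast
  ultimately show ?thesis
    by (simp add: closedin_def topspace_affine_zariski Compl_eq_Diff_UNIV)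
qed

lemma closedin_affine_zariski_coordinate: "closedin affine_zariski {x :: real ^ 'n::finite. x $ i = c}"
  using closedin_affine_zariski_zeros
    [of "Poly_Mapping.single (Poly_Mapping.single i (Suc 0)) 1 + Poly_Mapping.single 0 (- c)"]
  by (simp add: eval_at_add eval_at_const eval_at_variable)

lemma closedin_affine_zariski_point: "closedin affine_zariski {p :: real ^ 'n::finite}"
proof -
  have "{p} = (\<Inter>i. {x. x $ i = p $ i})"
    by (auto simp: vec_eq_iff)
  moreover have "closedin affine_zariski (\<Inter>i. {x. x $ i = p $ i})"
    by (intro closedin_Inter) (auto simp: closedin_affine_zariski_coordinate)
  ultimately show ?thesis by simp
qed

text \<open>A basic open set meets the line where a polynomial in \<open>s\<close> is nonzero, and both alternatives
  are stable under finite intersections and arbitrary unions of open sets.\<close>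

lemma openin_affine_zariski_line:
  assumes "openin affine_zariski U"
  shows "finite {s. v + s *s w \<notin> U} \<or> {s. v + s *s w \<notin> U} = UNIV"
proof -
  have "generate_topology_on {{x. eval_at f x \<noteq> 0} | f. True} U"
    using assms by (simp add: affine_zariski_def openin_topology_generated_by_iff)
  then show ?thesis
  proof induction
    case Empty
    show ?case by simp
  next
    case (Int A B)
    have *: "{s. v + s *s w \<notin> A \<inter> B} = {s. v + s *s w \<notin> A} \<union> {s. v + s *s w \<notin> B}"
      by blast
    show ?case
      using Int.IH unfolding *
      by (elim disjE) (simp_all only: finite_Un Un_UNIV_left Un_UNIV_right simp_thms)
  next
    case (UN K)
    show ?case
    proof (cases "\<exists>A\<in>K. finite {s. v + s *s w \<notin> A}")
      case True
      then obtain A where "A \<in> K" "finite {s. v + s *s w \<notin> A}" by blast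
      moreover from this have "{s. v + s *s w \<notin> \<Union>K} \<subseteq> {s. v + s *s w \<notin> A}" by blast
      ultimately show ?thesis using finite_subset by blast
    next
      case False
      with UN have "\<forall>A\<in>K. {s. v + s *s w \<notin> A} = UNIV" by blast
      then show ?thesis by blast
    qed
  next
    case (Basis S)
    then obtain f where "S = {x. eval_at f x \<noteq> 0}" by blast
    then have "{s. v + s *s w \<notin> S} = {s. poly (along_line f v w) s = 0}"
      by (simp add: poly_along_line)
    then show ?case
      by (cases "along_line f v w = 0") (simp_all add: poly_roots_finite)
  qed
qed

text \<open>If two closed sets both fail to contain \<open>S\<close>, the line through a point of \<open>S\<close> missed by
  the first and a point missed by the second meets each of them in finitely many points,
  yet it lies in \<open>S\<close>.\<close>

lemma irreducible_in_affine:
  assumes "affine S" "S \<noteq> {}"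
  shows "irreducible_in affine_zariski S"
  unfolding irreducible_in_def topspace_affine_zariski
proof (intro conjI allI impI)
  fix A B
  assume AB: "closedin affine_zariski A \<and> closedin affine_zariski B \<and> S \<subseteq> A \<union> B"
  show "S \<subseteq> A \<or> S \<subseteq> B"
  proof (rule ccontr)
    assume "\<not> ?thesis"
    then obtain a b where a: "a \<in> S" "a \<notin> A" and b: "b \<in> S" "b \<notin> B" by blast
    let ?line = "\<lambda>s. a + s *s (b - a)"
    have line: "?line s \<in> S" for s
    proof -
      have "?line s = (1 - s) *\<^sub>R a + s *\<^sub>R b"
        by (simp add: vec_eq_iff algebra_simps)
      then show ?thesis
        using assms(1) a b by (simp add: affine_def)
    qed
    have fin: "finite {s. ?line s \<in> D}"
      if "closedin affine_zariski D" "?line t \<notin> D" for D t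
    proof -
      have "openin affine_zariski (- D)"
        using that(1) by (simp add: closedin_def topspace_affine_zariski Compl_eq_Diff_UNIV)
      from openin_affine_zariski_line[OF this, of a "b - a"] show ?thesis
        using that(2) by auto
    qed
    have "finite ({s. ?line s \<in> A} \<union> {s. ?line s \<in> B})"
      using fin[of A 0] fin[of B 1] AB a b by simp
    moreover have "{s. ?line s \<in> A} \<union> {s. ?line s \<in> B} = UNIV"
      using line AB by blast
    ultimately show False
      using infinite_UNIV_char_0 by metis
  qed
qed (use assms in auto)

lemma plane_not_krull_dim_1: "\<not> has_krull_dim affine_zariski (UNIV :: (real ^ 2) set) 1"
proof
  assume dim: "has_krull_dim affine_zariski (UNIV :: (real ^ 2) set) 1"
  define Z :: "nat \<Rightarrow> (real ^ 2) set" where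
    "Z i = (if i = 0 then {0} else if i = 1 then {x. x $ 1 = 0} else UNIV)" for i
  have "axis 2 1 \<in> Z 1 - Z 0" "axis 1 1 \<in> Z 2 - Z 1"
    by (auto simp: Z_def axis_def vec_eq_iff)
  moreover have "Z 0 \<subseteq> Z 1" "Z 1 \<subseteq> Z 2"
    by (simp_all add: Z_def)
  ultimately have "Z 0 \<subset> Z 1" "Z 1 \<subset> Z 2"
    by blast+
  then have "\<forall>i<2. Z i \<subset> Z (Suc i)"
    by (auto simp: less_Suc_eq numeral_2_eq_2)
  moreover have "closedin affine_zariski (Z i)" for i
    using closedin_topspace[of affine_zariski]
    by (auto simp: Z_def closedin_affine_zariski_point closedin_affine_zariski_coordinate
        topspace_affine_zariski)
  moreover have "irreducible_in affine_zariski (Z i)" for i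
  proof (rule irreducible_in_affine)
    show "affine (Z i)"
      by (auto simp: Z_def affine_def)
    have "0 \<in> Z i" by (simp add: Z_def)
    then show "Z i \<noteq> {}" by blast
  qed
  ultimately have "irreducible_chain affine_zariski UNIV Z 2"
    by (simp add: irreducible_chain_def)
  then show False
    using dim by (fastforce simp: has_krull_dim_def)
qed


section \<open>Semialgebraic configurations\<close>

lemma semialgebraic_curve_infinite:
  assumes "semialgebraic_curve \<gamma>"
  shows "infinite \<gamma>"
proof
  assume "finite \<gamma>"
  then have "closedin affine_zariski (\<Union>p\<in>\<gamma>. {p})"
    by (intro closedin_Union) (auto simp: closedin_affine_zariski_point)
  then have "affine_zariski closure_of \<gamma> = \<gamma>"
    by (simp add: closure_of_closedin)
  then have "has_krull_dim affine_zariski \<gamma> (Suc 0)"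
    using assms by (simp add: semialgebraic_curve_def)
  from has_krull_dim_Suc_infinite[OF this closedin_affine_zariski_point] show False
    using \<open>finite \<gamma>\<close> by blast
qed

lemma semialgebraic_configuration_arrangement:
  assumes "semialgebraic_configuration \<D>"
  shows "curve_arrangement UNIV \<D>"
proof
  have curve: "\<And>\<gamma>. \<gamma> \<in> \<D> \<Longrightarrow> semialgebraic_curve \<gamma>"
    using assms by (auto simp: semialgebraic_configuration_def)
  show "finite \<D>" and fin: "finite (Sing \<D>)"
    using assms by (auto simp: semialgebraic_configuration_def)
  show "\<gamma> \<subset> UNIV" if "\<gamma> \<in> \<D>" for \<gamma>
  proof -
    have "\<not> semialgebraic_curve UNIV"
      using plane_not_krull_dim_1 closure_of_topspace[of affine_zariski]
      by (auto simp: semialgebraic_curve_def topspace_affine_zariski)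
    then show ?thesis
      using curve[OF that] by blast
  qed
  show "\<not> \<gamma> \<subset> \<gamma>'" if "\<gamma> \<in> \<D>" "\<gamma>' \<in> \<D>" for \<gamma> \<gamma>'
  proof
    assume "\<gamma> \<subset> \<gamma>'"
    then have "\<gamma> \<subseteq> Sing \<D>"
      using that by (auto simp: Sing_def)
    then show False
      using fin semialgebraic_curve_infinite[OF curve[OF that(1)]] finite_subset by blast
  qed
  show "\<gamma> \<noteq> {p}" if "\<gamma> \<in> \<D>" for \<gamma> p
    using semialgebraic_curve_infinite[OF curve[OF that]] by auto
qed


section \<open>Deletion and restriction\<close>

theorem theorem8p10:
  fixes \<Sigma> :: "('k::alg_closed_field ^ 'n::finite) set set"
    and \<C> :: "('k ^ 'n) set set set" and \<gamma>\<^sub>0 :: "('k ^ 'n) set set"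
    and \<D> :: "(real ^ 2) set set" and \<delta>\<^sub>0 :: "(real ^ 2) set"
  shows "(projective_configuration \<Sigma> \<C> \<and> \<gamma>\<^sub>0 \<in> \<C> \<longrightarrow>
      chi \<Sigma> \<C> = chi \<Sigma> (\<C> - {\<gamma>\<^sub>0}) - chi_points \<gamma>\<^sub>0 (restricted_arrangement \<C> \<gamma>\<^sub>0))
    \<and> (semialgebraic_configuration \<D> \<and> \<delta>\<^sub>0 \<in> \<D> \<longrightarrow>
      chi UNIV \<D> = chi UNIV (\<D> - {\<delta>\<^sub>0}) - chi_points \<delta>\<^sub>0 (restricted_arrangement \<D> \<delta>\<^sub>0))"
  by (simp add: curve_arrangement.chi_deletion_restriction
      projective_configuration_arrangement semialgebraic_configuration_arrangement)

end
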